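(* Let $G$ be a graph and let $B$ be a PSD forcing set of $G$ with $|B|=k$. Let $C_1,C_2,\ldots,C_m$ be the connected components of $G-B$, indexed so that $\mathrm{pt}_+(G[V(C_i)\cup B];B)\leq \mathrm{pt}_+(G[V(C_{i+1})\cup B];B)$ for $i=1,\ldots,m-1$, where, when $G-B$ is connected, one uses the convention $C_1=\emptyset$ and $C_2=G-B$ (so $m=2$). If $B$ is $k$-efficient, then \[\mathrm{pt}_+(G[V(C_{m})\cup B];B)-\mathrm{pt}_+(G[V(C_{m-1})\cup B];B)\leq 1.\]
   Context: Graphs are finite and simple. PSD color change rule: let $B$ be the current set of blue vertices and let $W_1,\dots,W_r$ be the vertex sets of the components of $G-B$; if $u\in B$, $w\in W_i$, and $w$ is the only white neighbor of $u$ in $G[W_i\cup B]$, then $w$ may be colored blue. $B$ is a PSD forcing set if repeated application from exactly $B$ blue colors all vertices. For a graph $H$ and $B\subseteq V(H)$: $B^{[0]}=B$, $B^{[i+1]}$ is $B^{[i]}$ together with all vertices that can be PSD forced when exactly $B^{[i]}$ is blue, and $\mathrm{pt}_+(H;B)$ is the least $t$ with $B^{[t]}=V(H)$. $\mathrm{pt}_+(G,k)=\min_{|B|=k}\mathrm{pt}_+(G;B)$. A PSD forcing set $B$ with $|B|=k$ is $k$-efficient if $\mathrm{pt}_+(G;B)=\mathrm{pt}_+(G,k)$. *)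

theory Defs
  imports "Graph_Theory.Digraph_Component" "HOL-Library.Extended_Nat"
begin

text \<open>
  Finite simple graphs are the symmetric, loop-free digraphs without parallel arcs of
  \<^locale>\<open>graph\<close>. In a symmetric digraph the strongly connected components are the connected
  components, so \<^const>\<open>pre_digraph.sccs_verts\<close> yields their vertex sets.
\<close>

abbreviation minus_verts :: "('a, 'b) pre_digraph \<Rightarrow> 'a set \<Rightarrow> ('a, 'b) pre_digraph" where
  "minus_verts H B \<equiv> H \<restriction> (verts H - B)"

abbreviation components :: "('a, 'b) pre_digraph \<Rightarrow> 'a set set" where
  "components H \<equiv> pre_digraph.sccs_verts H"

definition psd_forces :: "('a, 'b) pre_digraph \<Rightarrow> 'a set \<Rightarrow> 'a \<Rightarrow> 'a \<Rightarrow> bool" where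
  "psd_forces H B u w \<longleftrightarrow> u \<in> B \<and>
     (\<exists>W \<in> components (minus_verts H B). w \<in> W \<and>
        {x \<in> verts (H \<restriction> (W \<union> B)) - B. u \<rightarrow>\<^bsub>H \<restriction> (W \<union> B)\<^esub> x} = {w})"

definition psd_color_change :: "('a, 'b) pre_digraph \<Rightarrow> 'a set \<Rightarrow> 'a set \<Rightarrow> bool" where
  "psd_color_change H B B' \<longleftrightarrow> (\<exists>u w. psd_forces H B u w \<and> B' = insert w B)"

definition psd_forcing_set :: "('a, 'b) pre_digraph \<Rightarrow> 'a set \<Rightarrow> bool" where
  "psd_forcing_set H B \<longleftrightarrow> B \<subseteq> verts H \<and> (psd_color_change H)\<^sup>*\<^sup>* B (verts H)"

primrec psd_blue :: "('a, 'b) pre_digraph \<Rightarrow> 'a set \<Rightarrow> nat \<Rightarrow> 'a set" where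
  "psd_blue H B 0 = B"
| "psd_blue H B (Suc i) = psd_blue H B i \<union> {w. \<exists>u. psd_forces H (psd_blue H B i) u w}"

text \<open>The propagation time is \<^term>\<open>\<infinity>\<close>, as infimum of the empty set, if no round colors everything.\<close>

definition psd_pt :: "('a, 'b) pre_digraph \<Rightarrow> 'a set \<Rightarrow> enat" where
  "psd_pt H B = Inf {enat t | t. psd_blue H B t = verts H}"

definition psd_pt_k :: "('a, 'b) pre_digraph \<Rightarrow> nat \<Rightarrow> enat" where
  "psd_pt_k H k = (INF B \<in> {B. B \<subseteq> verts H \<and> card B = k}. psd_pt H B)"

definition k_efficient :: "('a, 'b) pre_digraph \<Rightarrow> nat \<Rightarrow> 'a set \<Rightarrow> bool" where
  "k_efficient H k B \<longleftrightarrow> psd_forcing_set H B \<and> card B = k \<and> psd_pt H B = psd_pt_k H k"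

text \<open>
  The library's \<^const>\<open>Digraph_Component.connected\<close> excludes the null graph; here the null graph
  (the case where \<open>B\<close> contains all vertices) falls under the convention for connected \<open>H - B\<close>,
  so that \<open>C 1 = C 2 = {}\<close>. Hence \<open>m \<ge> 2\<close> in all cases.
\<close>

definition component_indexing ::
    "('a, 'b) pre_digraph \<Rightarrow> 'a set \<Rightarrow> nat \<Rightarrow> (nat \<Rightarrow> 'a set) \<Rightarrow> bool" where
  "component_indexing H B m C \<longleftrightarrow>
     (if Digraph_Component.connected (minus_verts H B) \<or> verts (minus_verts H B) = {}
      then m = 2 \<and> C 1 = {} \<and> C 2 = verts (minus_verts H B)
      else bij_betw C {1..m} (components (minus_verts H B)))"

end

theory Submission
  imports Defs
begin

text \<open>
  Forcing inside a component of \<open>G - B\<close> ignores the other components. If the slowest component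
  \<open>C m\<close> lagged at least two rounds behind all the others, exchange first-round forcers of
  \<open>C m\<close> for the vertices they force. From the new set of the same size, \<open>C m\<close> finishes one
  round earlier and the exchanged forcers are recovered after one round, so every other component
  finishes at most one round later. The total time thus drops, contradicting efficiency.
\<close>

section \<open>Forces in terms of reachability\<close>

lemma dominates_induce_subgraph_iff:
  "a \<rightarrow>\<^bsub>G \<restriction> S\<^esub> b \<longleftrightarrow> a \<rightarrow>\<^bsub>G\<^esub> b \<and> a \<in> S \<and> b \<in> S"
  by (auto simp: arcs_ends_def arc_to_ends_def)

text \<open>Induction along the walk with membership in \<open>A\<close> as invariant. All later
  comparisons of white components, between two blue sets or between a graph and an induced subgraph,
  are instances.\<close>

lemma reachable_minus_verts_transfer:
  assumes "w \<rightarrow>\<^sup>*\<^bsub>minus_verts H Y\<^esub> x" and "w \<in> A" and "w \<in> verts H' - X"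
    and step: "\<And>a b. \<lbrakk>a \<in> A; a \<in> verts H' - X; a \<in> verts H - Y; b \<in> verts H - Y; a \<rightarrow>\<^bsub>H\<^esub> b\<rbrakk>
                \<Longrightarrow> b \<in> A \<and> b \<in> verts H' - X \<and> a \<rightarrow>\<^bsub>H'\<^esub> b"
  shows "x \<in> A \<and> w \<rightarrow>\<^sup>*\<^bsub>minus_verts H' X\<^esub> x"
proof -
  have "x \<in> A \<and> x \<in> verts H' - X \<and> (w, x) \<in> rtrancl_on (verts H' - X) (arcs_ends (minus_verts H' X))"
    using assms(1) unfolding reachable_def induce_subgraph_verts
  proof (induction rule: rtrancl_on_induct)
    case base
    then show ?case using assms(2,3) by auto
  next
    case (step y z)
    then have "z \<in> A \<and> z \<in> verts H' - X \<and> y \<rightarrow>\<^bsub>H'\<^esub> z"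
      using assms(4)[of y z] by (simp add: dominates_induce_subgraph_iff)
    with step show ?case
      by (auto simp: dominates_induce_subgraph_iff intro: rtrancl_on_into_rtrancl_on)
  qed
  then show ?thesis by (simp add: reachable_def)
qed

lemma (in sym_digraph) sym_digraph_induce_subgraph:
  assumes "S \<subseteq> verts G"
  shows "sym_digraph (G \<restriction> S)"
  using assms by (intro induced_graph_imp_graph) auto

lemma (in sym_digraph) mem_sccs_verts_iff_reachable:
  assumes "S \<in> sccs_verts" "u \<in> S"
  shows "v \<in> S \<longleftrightarrow> u \<rightarrow>\<^sup>*\<^bsub>G\<^esub> v"
  using assms symmetric_reachable[OF sym_arcs] unfolding in_sccs_verts_conv_reachable by blast

text \<open>The component witnessing a force must be the one containing \<open>w\<close>; as arcs
  are symmetric, it consists of the vertices reachable from \<open>w\<close> once \<open>X\<close>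
  is deleted.\<close>

lemma (in sym_digraph) psd_forces_iff:
  "psd_forces G X u w \<longleftrightarrow> u \<in> X \<and> w \<in> verts G - X \<and> u \<rightarrow>\<^bsub>G\<^esub> w \<and>
     (\<forall>x. u \<rightarrow>\<^bsub>G\<^esub> x \<and> w \<rightarrow>\<^sup>*\<^bsub>minus_verts G X\<^esub> x \<longrightarrow> x = w)" (is "?L \<longleftrightarrow> ?R")
proof -
  interpret M: sym_digraph "minus_verts G X"
    by (rule sym_digraph_induce_subgraph) simp
  have nbrs: "{x \<in> verts (G \<restriction> (W \<union> X)) - X. u \<rightarrow>\<^bsub>G \<restriction> (W \<union> X)\<^esub> x} = {x \<in> W - X. u \<rightarrow>\<^bsub>G\<^esub> x}"
    if "u \<in> X" for W
    using that by (auto simp: dominates_induce_subgraph_iff)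
  show ?thesis
  proof
    assume ?L
    then obtain W where W: "u \<in> X" "W \<in> M.sccs_verts" "w \<in> W" "{x \<in> W - X. u \<rightarrow>\<^bsub>G\<^esub> x} = {w}"
      unfolding psd_forces_def using nbrs by auto
    moreover have "W \<subseteq> verts G - X"
      using M.sccs_verts_subsets[OF W(2)] by simp
    ultimately show ?R
      using M.mem_sccs_verts_iff_reachable[OF W(2,3)] by blast
  next
    assume R: ?R
    let ?W = "M.scc_of w"
    have w: "w \<in> verts (minus_verts G X)" using R by simp
    have W: "?W \<in> M.sccs_verts" "w \<in> ?W"
      using M.scc_of_in_sccs_verts[OF w] M.in_scc_of_self[OF w] by auto
    have "?W \<subseteq> verts G - X"
      using M.sccs_verts_subsets[OF W(1)] by simp
    then have "{x \<in> ?W - X. u \<rightarrow>\<^bsub>G\<^esub> x} = {w}"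
      using R W(2) M.mem_sccs_verts_iff_reachable[OF W] by auto
    then show ?L unfolding psd_forces_def using nbrs R W by auto
  qed
qed

section \<open>Locality and monotonicity of forcing\<close>

text \<open>\<open>C\<close> is a union of components of \<open>G - B\<close>.\<close>

definition separated_part :: "('a, 'b) pre_digraph \<Rightarrow> 'a set \<Rightarrow> 'a set \<Rightarrow> bool" where
  "separated_part G B C \<longleftrightarrow> C \<subseteq> verts G - B \<and> (\<forall>a \<in> C. \<forall>b. a \<rightarrow>\<^bsub>G\<^esub> b \<longrightarrow> b \<in> C \<union> B)"

context sym_digraph
begin

text \<open>All of \<open>B\<close> is blue in both \<open>X\<close> and \<open>Y\<close>, so a
  white walk from \<open>w\<close> cannot leave \<open>C\<close>, and there every vertex white under
  \<open>Y\<close> is white under \<open>X\<close>. Thus the white component of \<open>w\<close> can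
  only shrink; outside \<open>C \<union> B\<close> the two sets may differ freely.\<close>

lemma psd_forces_local_mono:
  assumes C: "separated_part G B C" and "B \<subseteq> X" "X \<inter> (C \<union> B) \<subseteq> Y"
    and "w \<in> C" "w \<notin> Y" and f: "psd_forces G X u w"
  shows "psd_forces G Y u w"
proof -
  \<comment> \<open>The forcer is adjacent to \<open>w\<close>, so it cannot lie beyond
    \<open>B\<close>; hence it is blue in \<open>Y\<close> too.\<close>
  have "u \<in> C \<union> B"
    using C f \<open>w \<in> C\<close> graph_symmetric[of u w] unfolding separated_part_def psd_forces_iff by blast
  moreover have "x = w" if ux: "u \<rightarrow>\<^bsub>G\<^esub> x" and r: "w \<rightarrow>\<^sup>*\<^bsub>minus_verts G Y\<^esub> x" for x
  proof -
    have "x \<in> C \<and> w \<rightarrow>\<^sup>*\<^bsub>minus_verts G X\<^esub> x"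
    proof (rule reachable_minus_verts_transfer[OF r \<open>w \<in> C\<close>])
      show "w \<in> verts G - X" using f by (simp add: psd_forces_iff)
      show "b \<in> C \<and> b \<in> verts G - X \<and> a \<rightarrow>\<^bsub>G\<^esub> b"
        if "a \<in> C" "b \<in> verts G - Y" "a \<rightarrow>\<^bsub>G\<^esub> b" for a b
        using that C assms(2,3) unfolding separated_part_def by blast
    qed
    then show ?thesis using f ux by (simp add: psd_forces_iff)
  qed
  ultimately show ?thesis using f assms(3,5) by (auto simp: psd_forces_iff)
qed

lemma separated_part_verts: "separated_part G {} (verts G)"
  by (auto simp: separated_part_def adj_in_verts)

text \<open>The local version with empty separator and \<open>C\<close> the whole vertex
  set.\<close>

lemma psd_forces_mono:
  assumes "X \<subseteq> Y" "w \<notin> Y" "psd_forces G X u w"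
  shows "psd_forces G Y u w"
  using assms
  by (intro psd_forces_local_mono[OF separated_part_verts _ _ _ _ assms(3)]) (auto simp: psd_forces_iff)

text \<open>White walks from \<open>w\<close> stay in \<open>C\<close> and neighbors of
  \<open>w\<close> lie in \<open>C \<union> B\<close>, so the restriction loses neither a possible
  forcer nor a competing white neighbor.\<close>

lemma psd_forces_induce_subgraph:
  assumes C: "separated_part G B C" and B: "B \<subseteq> X" "B \<subseteq> verts G" and "w \<in> C"
  shows "psd_forces (G \<restriction> (C \<union> B)) (X \<inter> (C \<union> B)) u w \<longleftrightarrow> psd_forces G X u w"
proof -
  let ?S = "C \<union> B"
  have S: "?S \<subseteq> verts G" using C B by (auto simp: separated_part_def)
  interpret H: sym_digraph "G \<restriction> ?S" by (rule sym_digraph_induce_subgraph[OF S])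
  have reach: "w \<rightarrow>\<^sup>*\<^bsub>minus_verts (G \<restriction> ?S) (X \<inter> ?S)\<^esub> x \<longleftrightarrow> w \<rightarrow>\<^sup>*\<^bsub>minus_verts G X\<^esub> x"
    (is "?L \<longleftrightarrow> ?R") if wX: "w \<notin> X" for x
  proof
    assume r: ?L
    have "x \<in> UNIV \<and> ?R"
    proof (rule reachable_minus_verts_transfer[OF r UNIV_I])
      show "w \<in> verts G - X" using wX S \<open>w \<in> C\<close> by auto
    qed (use S in \<open>auto simp: dominates_induce_subgraph_iff\<close>)
    then show ?R by simp
  next
    assume r: ?R
    have "x \<in> C \<and> ?L"
    proof (rule reachable_minus_verts_transfer[OF r \<open>w \<in> C\<close>])
      show "w \<in> verts (G \<restriction> ?S) - X \<inter> ?S" using wX \<open>w \<in> C\<close> by simp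
      show "b \<in> C \<and> b \<in> verts (G \<restriction> ?S) - X \<inter> ?S \<and> a \<rightarrow>\<^bsub>G \<restriction> ?S\<^esub> b"
        if "a \<in> C" "b \<in> verts G - X" "a \<rightarrow>\<^bsub>G\<^esub> b" for a b
        using that C B unfolding separated_part_def
        by (simp add: dominates_induce_subgraph_iff) blast
    qed
    then show ?L by simp
  qed
  have nbr: "u \<rightarrow>\<^bsub>G\<^esub> x \<Longrightarrow> u \<in> ?S" if "x \<in> C" for x
    using that C graph_symmetric[of u x] unfolding separated_part_def by blast
  have rC: "x \<in> C" if r: "w \<rightarrow>\<^sup>*\<^bsub>minus_verts G X\<^esub> x" and "w \<notin> X" for x
  proof -
    have "x \<in> C \<and> w \<rightarrow>\<^sup>*\<^bsub>minus_verts G X\<^esub> x"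
    proof (rule reachable_minus_verts_transfer[OF r \<open>w \<in> C\<close>])
      show "w \<in> verts G - X" using \<open>w \<notin> X\<close> S \<open>w \<in> C\<close> by auto
    qed (use C B in \<open>unfold separated_part_def, blast\<close>)
    then show ?thesis ..
  qed
  have w: "w \<in> ?S" "w \<in> verts G" using \<open>w \<in> C\<close> S by auto
  show ?thesis
    unfolding psd_forces_iff H.psd_forces_iff dominates_induce_subgraph_iff induce_subgraph_verts
    using reach rC nbr w \<open>w \<in> C\<close> by auto
qed

section \<open>Blue sets round by round\<close>

lemma psd_blue_incseq: "s \<le> t \<Longrightarrow> psd_blue G B s \<subseteq> psd_blue G B t"
  by (rule lift_Suc_mono_le) auto

lemma psd_blue_subset_verts: "B \<subseteq> verts G \<Longrightarrow> psd_blue G B t \<subseteq> verts G"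
  by (induction t) (auto simp: psd_forces_iff)

text \<open>By monotonicity of forcing, a start that is \<open>s\<close> rounds late never falls
  further behind.\<close>

lemma psd_blue_mono:
  assumes "B \<subseteq> psd_blue G B' s"
  shows "psd_blue G B t \<subseteq> psd_blue G B' (s + t)"
proof (induction t)
  case (Suc t)
  then show ?case using psd_forces_mono[OF Suc.IH] by auto
qed (use assms in simp)

text \<open>The separate offsets \<open>r\<close> and \<open>s\<close> let a lead inside
  \<open>C\<close> persist, whatever happens elsewhere. The main argument takes \<open>r = 2\<close>
  and \<open>s = 1\<close>, a gain of one round.\<close>

lemma psd_blue_local_mono:
  assumes C: "separated_part G B C"
    and "psd_blue G B r \<inter> (C \<union> B) \<subseteq> psd_blue G B' s"
  shows "psd_blue G B (r + t) \<inter> (C \<union> B) \<subseteq> psd_blue G B' (s + t)"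
proof (induction t)
  case (Suc t)
  let ?X = "psd_blue G B (r + t)" and ?Y = "psd_blue G B' (s + t)"
  have B: "B \<subseteq> ?X" using psd_blue_incseq[of 0 "r + t" B] by simp
  have "w \<in> psd_blue G B' (s + Suc t)" if "psd_forces G ?X u w" "w \<in> C \<union> B" for u w
  proof -
    have "w \<in> C" using that B by (auto simp: psd_forces_iff)
    then show ?thesis
      using psd_forces_local_mono[OF C B Suc.IH _ _ that(1)] by auto
  qed
  with Suc show ?case by auto
qed (use assms in simp)

text \<open>Vertices of \<open>B\<close> are blue from the start, so only targets in
  \<open>C\<close> matter, and forces on these survive the restriction.\<close>

lemma psd_blue_induce_subgraph:
  assumes C: "separated_part G B C" and B: "B \<subseteq> verts G"
  shows "psd_blue (G \<restriction> (C \<union> B)) B t = psd_blue G B t \<inter> (C \<union> B)"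
proof (induction t)
  case (Suc t)
  let ?S = "C \<union> B" and ?X = "psd_blue G B t"
  have S: "?S \<subseteq> verts G" using C B by (auto simp: separated_part_def)
  interpret H: sym_digraph "G \<restriction> ?S" by (rule sym_digraph_induce_subgraph[OF S])
  have BX: "B \<subseteq> ?X" using psd_blue_incseq[of 0 t B] by simp
  have "psd_forces (G \<restriction> ?S) (?X \<inter> ?S) u w \<longleftrightarrow> psd_forces G ?X u w \<and> w \<in> ?S" for u w
  proof (cases "w \<in> C")
    case True
    then show ?thesis using psd_forces_induce_subgraph[OF C BX B] by simp
  next
    case False
    then show ?thesis using BX by (auto simp: psd_forces_iff H.psd_forces_iff)
  qed
  with Suc show ?case by auto
qed simp

text \<open>Forcing in rounds keeps up with forcing one vertex at a time: by monotonicity, each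
  single force costs at most one further round.\<close>

lemma psd_forcing_set_imp_psd_blue:
  assumes "psd_forcing_set G B"
  shows "\<exists>t. psd_blue G B t = verts G"
proof -
  have "(psd_color_change G)\<^sup>*\<^sup>* B X \<Longrightarrow> \<exists>t. X \<subseteq> psd_blue G B t" for X
  proof (induction rule: rtranclp_induct)
    case base
    have "B \<subseteq> psd_blue G B 0" by simp
    then show ?case ..
  next
    case (step X Y)
    then obtain t u w where *: "X \<subseteq> psd_blue G B t" "psd_forces G X u w" "Y = insert w X"
      by (auto simp: psd_color_change_def)
    then have "Y \<subseteq> psd_blue G B (Suc t)" using psd_forces_mono[OF *(1) _ *(2)] by auto
    then show ?case ..
  qed
  then show ?thesis
    using assms psd_blue_subset_verts[of B] unfolding psd_forcing_set_def by blast
qed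

end

section \<open>Propagation time as an attained minimum\<close>

lemma psd_pt_le: "psd_blue H B t = verts H \<Longrightarrow> psd_pt H B \<le> enat t"
  unfolding psd_pt_def by (rule Inf_lower) auto

lemma psd_pt_attained:
  assumes "psd_pt H B \<noteq> \<infinity>"
  shows "\<exists>t. psd_pt H B = enat t \<and> psd_blue H B t = verts H"
proof -
  let ?A = "{enat t | t. psd_blue H B t = verts H}"
  have "?A \<noteq> {}" using assms unfolding psd_pt_def by (metis Inf_enat_def)
  then have "Inf ?A \<in> ?A" unfolding Inf_enat_def by (metis (mono_tags, lifting) LeastI equals0I)
  then show ?thesis unfolding psd_pt_def by auto
qed

section \<open>Migrating a forcing set into one component\<close>

text \<open>
  \<open>B'\<close> swaps chosen first-round forcers of \<open>C\<close> for the vertices they force. A swapped-out forcer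
  has no white neighbor left in \<open>C\<close>, so its loss does not delay \<open>C\<close>; and it is the only white
  neighbor outside \<open>C\<close> of the vertex it forced, so it is forced back in the first round.
\<close>

lemma (in pseudo_graph) psd_migration:
  assumes C: "separated_part G B C" and B: "B \<subseteq> verts G"
    and conn: "\<And>v w. v \<in> C \<Longrightarrow> w \<in> C \<Longrightarrow> v \<rightarrow>\<^sup>*\<^bsub>minus_verts G B\<^esub> w"
  obtains B' where "B' \<subseteq> verts G" "card B' = card B"
    "B \<subseteq> psd_blue G B' 1" "psd_blue G B 2 \<inter> (C \<union> B) \<subseteq> psd_blue G B' 1"
proof -
  \<comment> \<open>\<open>W\<close> is what \<open>C\<close> gains in the first round, and
    \<open>f\<close> picks one forcer for each vertex gained.\<close>
  define W where "W = {w \<in> C. \<exists>u. psd_forces G B u w}"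
  define f where "f w = (SOME u. psd_forces G B u w)" for w
  define B' where "B' = (B - f ` W) \<union> W"
  let ?B1 = "psd_blue G B 1"
  have B1: "?B1 \<inter> C = W"
    using C unfolding separated_part_def W_def by auto
  have f: "psd_forces G B (f w) w" if "w \<in> W" for w
    using that unfolding W_def f_def by (auto intro: someI)
  have fB: "f w \<in> B" and fw: "f w \<rightarrow>\<^bsub>G\<^esub> w" if "w \<in> W" for w
    using f[OF that] by (auto simp: psd_forces_iff)
  \<comment> \<open>By \<open>conn\<close>, all of \<open>C\<close> is white and reachable from
    \<open>w\<close>, so uniqueness of the white neighbor extends to all of
    \<open>C\<close>.\<close>
  have only: "x = w" if "w \<in> W" "x \<in> C" "f w \<rightarrow>\<^bsub>G\<^esub> x" for w x
    using f[of w] conn[of w x] that by (auto simp: psd_forces_iff W_def)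
  have WC: "W \<subseteq> C" and CB: "C \<inter> B = {}" and CV: "C \<subseteq> verts G"
    using C by (auto simp: W_def separated_part_def)
  have nbr: "b \<in> C \<union> B" if "a \<in> C" "a \<rightarrow>\<^bsub>G\<^esub> b" for a b
    using C that by (auto simp: separated_part_def)
  have restored: "f w \<in> psd_blue G B' 1" if w: "w \<in> W" for w
  proof -
    have "x = f w" if wx: "w \<rightarrow>\<^bsub>G\<^esub> x" and r: "f w \<rightarrow>\<^sup>*\<^bsub>minus_verts G B'\<^esub> x" for x
    proof -
      \<comment> \<open>A white walk starting outside \<open>C\<close> could enter \<open>C\<close>
        only through a swapped-out forcer, but the sole neighbor of such a forcer in
        \<open>C\<close> belongs to \<open>W\<close> and is blue.\<close>
      have "x \<in> - C \<and> f w \<rightarrow>\<^sup>*\<^bsub>minus_verts G B'\<^esub> x"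
      proof (rule reachable_minus_verts_transfer[OF r])
        show "f w \<in> - C" "f w \<in> verts G - B'"
          using fB[OF w] w B CB WC unfolding B'_def by auto
        show "b \<in> - C \<and> b \<in> verts G - B' \<and> a \<rightarrow>\<^bsub>G\<^esub> b"
          if a: "a \<in> - C" "a \<in> verts G - B'" and b: "b \<in> verts G - B'" and ab: "a \<rightarrow>\<^bsub>G\<^esub> b" for a b
        proof -
          have "b \<notin> C"
          proof
            assume "b \<in> C"
            then have "a \<in> f ` W"
              using nbr[of b a] graph_symmetric[OF ab] a unfolding B'_def by auto
            then have "b \<in> W" using only \<open>b \<in> C\<close> ab by blast
            then show False using b unfolding B'_def by auto
          qed
          then show ?thesis using b ab by simp
        qed
      qed
      moreover have "x \<notin> B'"
        using r by (auto simp: reachable_def dest: in_rtrancl_on_in_F)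
      ultimately have "x \<in> f ` W" using nbr[OF _ wx] w WC unfolding B'_def by auto
      then show ?thesis using only[of _ w] graph_symmetric[OF wx] w WC by blast
    qed
    moreover have "f w \<in> verts G - B'" "w \<in> B'"
      using fB[OF w] w B CB WC unfolding B'_def by auto
    ultimately have "psd_forces G B' w (f w)"
      using graph_symmetric[OF fw[OF w]] by (simp add: psd_forces_iff)
    then show ?thesis by auto
  qed
  have advance: "v \<in> psd_blue G B' 1" if v: "v \<in> C" and uv: "psd_forces G ?B1 u v" for u v
  proof -
    have vV: "v \<in> verts G - ?B1" "u \<in> ?B1" and e: "u \<rightarrow>\<^bsub>G\<^esub> v"
      using uv by (simp_all only: psd_forces_iff)
    have vB': "v \<notin> B'" using vV B1 v CB unfolding B'_def by auto
    have "u \<in> C \<union> B" using nbr[OF v graph_symmetric[OF e]] .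
    moreover have "u \<notin> f ` W" using only[OF _ v] e vB' unfolding B'_def by auto
    ultimately have uB': "u \<in> B'" using vV(2) B1 unfolding B'_def by blast
    have "x = v" if ux: "u \<rightarrow>\<^bsub>G\<^esub> x" and r: "v \<rightarrow>\<^sup>*\<^bsub>minus_verts G B'\<^esub> x" for x
    proof -
      have "x \<in> C \<and> v \<rightarrow>\<^sup>*\<^bsub>minus_verts G ?B1\<^esub> x"
      proof (rule reachable_minus_verts_transfer[OF r v vV(1)])
        show "b \<in> C \<and> b \<in> verts G - ?B1 \<and> a \<rightarrow>\<^bsub>G\<^esub> b"
          if a: "a \<in> C" "a \<in> verts G - B'" and b: "b \<in> verts G - B'" and ab: "a \<rightarrow>\<^bsub>G\<^esub> b" for a b
        proof -
          have "b \<notin> f ` W"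
            using only[OF _ a(1)] graph_symmetric[OF ab] a(2) unfolding B'_def by auto
          then have "b \<in> C" "b \<notin> W" using nbr[OF a(1) ab] b unfolding B'_def by auto
          then show ?thesis using B1 b ab by blast
        qed
      qed
      then show ?thesis using uv ux unfolding psd_forces_iff by blast
    qed
    then have "psd_forces G B' u v"
      using uB' vV vB' e by (simp add: psd_forces_iff)
    then show ?thesis by auto
  qed
  show thesis
  proof
    show "B' \<subseteq> verts G" using B WC CV unfolding B'_def by blast
    show BB: "B \<subseteq> psd_blue G B' 1" using restored unfolding B'_def by auto
    \<comment> \<open>A forcer has only one neighbor in \<open>C\<close>, so distinct gained
      vertices have distinct forcers and the swap preserves the size.\<close>
    have "inj_on f W"
    proof (rule inj_onI)
      fix w w' assume "w \<in> W" "w' \<in> W" "f w = f w'"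
      then show "w = w'" using only[of w' w] fw[of w] WC by auto
    qed
    then have "card (f ` W) = card W" by (rule card_image)
    moreover have "f ` W \<subseteq> B" using fB by blast
    moreover have fin: "finite B" "finite W"
      using B WC CV finite_verts by (blast intro: finite_subset)+
    moreover have "card (f ` W) \<le> card B"
      using fin(1) \<open>f ` W \<subseteq> B\<close> by (rule card_mono)
    moreover have "(B - f ` W) \<inter> W = {}" using WC CB by auto
    ultimately show "card B' = card B" unfolding B'_def
      by (simp add: card_Un_disjoint card_Diff_subset)
    have "psd_blue G B 2 = ?B1 \<union> {w. \<exists>u. psd_forces G ?B1 u w}"
      by (simp add: numeral_2_eq_2)
    moreover have "W \<subseteq> psd_blue G B' 1" unfolding B'_def by auto
    ultimately show "psd_blue G B 2 \<inter> (C \<union> B) \<subseteq> psd_blue G B' 1"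
      using BB B1 advance by blast
  qed
qed

section \<open>The components of \<open>G - B\<close>\<close>

context sym_digraph
begin

lemma separated_part_component:
  assumes "S \<in> components (minus_verts G B)"
  shows "separated_part G B S"
proof -
  interpret M: sym_digraph "minus_verts G B"
    by (rule sym_digraph_induce_subgraph) simp
  have S: "S \<subseteq> verts G - B"
    using M.sccs_verts_subsets[OF assms] by simp
  have "b \<in> S" if "a \<in> S" "a \<rightarrow>\<^bsub>G\<^esub> b" "b \<notin> B" for a b
  proof -
    have "a \<rightarrow>\<^bsub>minus_verts G B\<^esub> b"
      using that S adj_in_verts by (auto simp: dominates_induce_subgraph_iff)
    then show ?thesis
      using M.mem_sccs_verts_iff_reachable[OF assms \<open>a \<in> S\<close>] M.reachable_adjI by blast
  qed
  with S show ?thesis by (auto simp: separated_part_def)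
qed

text \<open>Merges the convention for connected or empty \<open>minus_verts G B\<close> with the
  genuine indexing of components. The empty \<open>C 1\<close> of the convention meets the second
  and third conditions vacuously.\<close>

lemma component_indexing_properties:
  assumes "component_indexing G B m C"
  shows "m \<ge> 2"
    and "\<forall>i \<in> {1..m}. separated_part G B (C i)"
    and "\<forall>i \<in> {1..m}. \<forall>v \<in> C i. \<forall>w \<in> C i. v \<rightarrow>\<^sup>*\<^bsub>minus_verts G B\<^esub> w"
    and "(\<Union>i \<in> {1..m}. C i) = verts G - B"
proof -
  let ?M = "minus_verts G B"
  interpret M: sym_digraph ?M
    by (rule sym_digraph_induce_subgraph) simp
  have "m \<ge> 2 \<and> (\<forall>i \<in> {1..m}. separated_part G B (C i)) \<and>
    (\<forall>i \<in> {1..m}. \<forall>v \<in> C i. \<forall>w \<in> C i. v \<rightarrow>\<^sup>*\<^bsub>?M\<^esub> w) \<and> (\<Union>i \<in> {1..m}. C i) = verts G - B"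
  proof (cases "Digraph_Component.connected ?M \<or> verts ?M = {}")
    case True
    then have mC: "m = 2" "C 1 = {}" "C 2 = verts G - B"
      using assms by (auto simp: component_indexing_def)
    have "\<forall>v \<in> verts ?M. \<forall>w \<in> verts ?M. v \<rightarrow>\<^sup>*\<^bsub>?M\<^esub> w"
      using True M.symmetric_connected_imp_strongly_connected[OF M.sym_arcs]
      by (auto simp: strongly_connected_def)
    moreover have "{1..m} = {1, 2}" using mC by auto
    ultimately show ?thesis
      using mC by (auto simp: separated_part_def adj_in_verts)
  next
    case False
    then have bij: "bij_betw C {1..m} M.sccs_verts" and ne: "verts ?M \<noteq> {}"
      using assms by (auto simp: component_indexing_def)
    have img: "C ` {1..m} = M.sccs_verts" using bij by (rule bij_betw_imp_surj_on)
    have cover: "(\<Union>i \<in> {1..m}. C i) = verts ?M"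
    proof
      show "(\<Union>i \<in> {1..m}. C i) \<subseteq> verts ?M" using img M.sccs_verts_subsets by blast
      show "verts ?M \<subseteq> (\<Union>i \<in> {1..m}. C i)"
        using img M.scc_of_in_sccs_verts M.in_scc_of_self by blast
    qed
    have conn: "v \<rightarrow>\<^sup>*\<^bsub>?M\<^esub> w" if "i \<in> {1..m}" "v \<in> C i" "w \<in> C i" for i v w
      using that img M.mem_sccs_verts_iff_reachable by blast
    have "m \<ge> 2"
    proof (rule ccontr)
      assume "\<not> m \<ge> 2"
      then have "m = 0 \<or> m = 1" by auto
      then have "m = 1" "C 1 = verts ?M" using cover ne by auto
      then have "\<forall>v \<in> verts ?M. \<forall>w \<in> verts ?M. v \<rightarrow>\<^sup>*\<^bsub>?M\<^esub> w"
        using conn[of 1] by auto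
      \<comment> \<open>\<open>Digraph_Component.connected\<close> refers to the symmetric closure
        of the arcs, so reachability is first moved there.\<close>
      moreover have "(v, w) \<in> rtrancl_on (verts ?M) ((arcs_ends ?M)\<^sup>s)" if "v \<rightarrow>\<^sup>*\<^bsub>?M\<^esub> w" for v w
        using that unfolding reachable_def
        by (rule rtrancl_on_mono[rotated 2]) (simp_all add: symcl_def)
      ultimately have "Digraph_Component.connected ?M"
        using ne unfolding connected_conv by blast
      then show False using False by simp
    qed
    moreover have "\<forall>i \<in> {1..m}. separated_part G B (C i)"
      using img separated_part_component by blast
    ultimately show ?thesis using conn cover by simp
  qed
  then show "m \<ge> 2"
    and "\<forall>i \<in> {1..m}. separated_part G B (C i)"
    and "\<forall>i \<in> {1..m}. \<forall>v \<in> C i. \<forall>w \<in> C i. v \<rightarrow>\<^sup>*\<^bsub>?M\<^esub> w"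
    and "(\<Union>i \<in> {1..m}. C i) = verts G - B" by simp_all
qed

section \<open>Propagation times of the pieces and of the whole graph\<close>

lemma psd_pt_induce_subgraph_le:
  assumes "separated_part G B C" "B \<subseteq> verts G"
  shows "psd_pt (G \<restriction> (C \<union> B)) B \<le> psd_pt G B"
proof (cases "psd_pt G B = \<infinity>")
  case False
  then obtain t where t: "psd_pt G B = enat t" "psd_blue G B t = verts G"
    using psd_pt_attained by blast
  have "psd_blue (G \<restriction> (C \<union> B)) B t = verts (G \<restriction> (C \<union> B))"
    using psd_blue_induce_subgraph[OF assms] t(2) assms by (auto simp: separated_part_def)
  then show ?thesis using t(1) psd_pt_le by metis
qed simp

lemma subset_psd_blue_of_psd_pt_le:
  assumes "separated_part G B C" "B \<subseteq> verts G" "psd_pt (G \<restriction> (C \<union> B)) B \<le> enat t"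
  shows "C \<union> B \<subseteq> psd_blue G B t"
proof -
  have "psd_pt (G \<restriction> (C \<union> B)) B \<noteq> \<infinity>" using assms(3) by (metis enat_ord_simps(5) enat.distinct(1))
  then obtain s where "psd_pt (G \<restriction> (C \<union> B)) B = enat s"
    "psd_blue (G \<restriction> (C \<union> B)) B s = verts (G \<restriction> (C \<union> B))"
    using psd_pt_attained by blast
  then show ?thesis
    using psd_blue_induce_subgraph[OF assms(1,2), of s] psd_blue_incseq[of s t B] assms(3) by auto
qed

end

theorem theorem3p4:
  fixes G :: "('a, 'b) pre_digraph" and B :: "'a set" and C :: "nat \<Rightarrow> 'a set" and k m :: nat
  assumes "Digraph.graph G"
    and "psd_forcing_set G B"
    and "card B = k"
    and "component_indexing G B m C"
    and "\<And>i. i \<in> {1..m - 1} \<Longrightarrow>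
           psd_pt (G \<restriction> (C i \<union> B)) B \<le> psd_pt (G \<restriction> (C (i + 1) \<union> B)) B"
    and "k_efficient G k B"
  shows "psd_pt (G \<restriction> (C m \<union> B)) B - psd_pt (G \<restriction> (C (m - 1) \<union> B)) B \<le> 1"
proof -
  interpret Digraph.graph G by fact
  have B: "B \<subseteq> verts G" using assms(2) by (simp add: psd_forcing_set_def)
  note idx = component_indexing_properties[OF assms(4)]
  have m: "m \<in> {1..m}" "m - 1 \<in> {1..m}" using idx(1) by auto
  define T where "T i = psd_pt (G \<restriction> (C i \<union> B)) B" for i
  have T_le: "T i \<le> psd_pt G B" if "i \<in> {1..m}" for i
    using that idx(2) psd_pt_induce_subgraph_le B unfolding T_def by blast
  \<comment> \<open>The ordering hypothesis compares neighboring indices only, hence the induction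
    on the distance to \<open>m - 1\<close>.\<close>
  have T_chain: "T i \<le> T (m - 1)" if "i \<in> {1..m - 1}" for i
    using that
  proof (induction "m - 1 - i" arbitrary: i)
    case 0
    then have "i = m - 1" by auto
    then show ?case by simp
  next
    case (Suc n)
    then have "T (i + 1) \<le> T (m - 1)" by auto
    moreover have "T i \<le> T (i + 1)" using assms(5)[OF Suc.prems] by (simp add: T_def)
    ultimately show ?case by simp
  qed
  \<comment> \<open>Finiteness makes both times natural numbers; in \<open>enat\<close>, subtracting
    from \<open>\<infinity>\<close> would give \<open>\<infinity>\<close>.\<close>
  have "psd_pt G B < \<infinity>"
  proof -
    obtain t where "psd_blue G B t = verts G" using psd_forcing_set_imp_psd_blue[OF assms(2)] ..
    from psd_pt_le[OF this] show ?thesis by (rule le_less_trans) simp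
  qed
  then obtain p q where p: "T (m - 1) = enat p" and q: "T m = enat q"
    using T_le[OF m(1)] T_le[OF m(2)] by (cases "T (m - 1)"; cases "T m") auto
  have "q \<le> p + 1"
  proof (rule ccontr)
    assume "\<not> q \<le> p + 1"
    \<comment> \<open>A gap of at least two gives \<open>q = 2 + d\<close> with
      \<open>p \<le> d\<close>. The aim is to finish from \<open>B'\<close> in \<open>1 + d\<close>
      rounds, one fewer than \<open>q\<close>.\<close>
    define d where "d = q - 2"
    have d: "q = 2 + d" "p \<le> d" using \<open>\<not> q \<le> p + 1\<close> by (auto simp: d_def)
    have Cm: "separated_part G B (C m)" using idx(2) m(1) by blast
    obtain B' where B': "B' \<subseteq> verts G" "card B' = card B"
      "B \<subseteq> psd_blue G B' 1" "psd_blue G B 2 \<inter> (C m \<union> B) \<subseteq> psd_blue G B' 1"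
      using psd_migration[OF Cm B] idx(3) m(1) by metis
    \<comment> \<open>For \<open>C m\<close>, two rounds from \<open>B\<close> are matched by one
      from \<open>B'\<close>, leaving \<open>d\<close> more. Any other piece needs at most
      \<open>d\<close> rounds from \<open>B\<close>, delayed by the one round that restores
      \<open>B\<close>.\<close>
    have "C i \<union> B \<subseteq> psd_blue G B' (1 + d)" if i: "i \<in> {1..m}" for i
    proof (cases "i = m")
      case True
      have "C m \<union> B \<subseteq> psd_blue G B q"
        using subset_psd_blue_of_psd_pt_le[OF Cm B] q by (simp add: T_def)
      then show ?thesis using psd_blue_local_mono[OF Cm B'(4), of d] d True by auto
    next
      case False
      then have "T i \<le> enat p" using T_chain[of i] i p by auto
      then have "C i \<union> B \<subseteq> psd_blue G B p"
        using subset_psd_blue_of_psd_pt_le[OF _ B] idx(2) i unfolding T_def by blast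
      also have "\<dots> \<subseteq> psd_blue G B d" using d(2) by (rule psd_blue_incseq)
      also have "\<dots> \<subseteq> psd_blue G B' (1 + d)" using B'(3) by (rule psd_blue_mono)
      finally show ?thesis .
    qed
    then have "verts G \<subseteq> psd_blue G B' (1 + d)" using idx(4) m(1) by blast
    then have "psd_pt G B' \<le> enat (1 + d)"
      using psd_blue_subset_verts[OF B'(1)] by (intro psd_pt_le subset_antisym)
    moreover have "psd_pt_k G k \<le> psd_pt G B'"
      unfolding psd_pt_k_def using B'(1,2) assms(3) by (intro INF_lower) auto
    \<comment> \<open>Efficiency enters here: \<open>q\<close> is at most the propagation time of
      \<open>B\<close>, which is minimal among sets of size \<open>k\<close>, while
      \<open>B'\<close> beats it.\<close>
    moreover have "enat q \<le> psd_pt_k G k"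
      using T_le[OF m(1)] q assms(6) by (simp add: k_efficient_def)
    ultimately have "enat q \<le> enat (1 + d)" by (meson order_trans)
    then show False using d by simp
  qed
  then show ?thesis using p q unfolding T_def by (simp add: one_enat_def)
qed

end
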